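(* Let $\tilde{\mathbf p}=(\tilde p_0,\tilde p_1,\dots,\tilde p_r,0,\dots,0)$ denote the $n$-vector of probabilities in the Costa--Farber model for random simplicial complexes. Let $Y\in\Delta_n^{(r)}$ be a simplicial complex on $[n]$ of dimension at most $r$ and let $I_Y$ be the Stanley--Reisner ideal corresponding to $Y$. Fix $D=r+1$ and specify the following probabilities $p_\alpha$, where $\alpha\in\mathbb N^n$ and $0<\|\alpha\|_1\le r+1$, for the general model for random monomials: $$p_\alpha=\begin{cases}1-\tilde p_{\deg(x^\alpha)-1},&\text{if }0\ne\alpha\in\{0,1\}^n,\\ 0,&\text{otherwise.}\end{cases}$$ Then $P_{CF}(Y)=P(I_Y)$, where the former is the probability under the Costa--Farber model and the latter is the probability under the distribution on random monomial ideals induced by the general model.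
   Context: $k$ is a field. An abstract simplicial complex on $[n]=\{1,\dots,n\}$ is a collection of subsets (faces) of $[n]$ closed under taking subsets. The dimension of a face $\sigma$ is $|\sigma|-1$ and the dimension of a complex is the maximum dimension of its faces. $\Delta_n^{(r)}$ is the set of all abstract simplicial complexes on $[n]$ of dimension at most $r$. The Stanley--Reisner ideal $I_Y\subseteq k[x_1,\dots,x_n]$ is the square-free monomial ideal generated by the monomials $\prod_{i\in\tau}x_i$ corresponding to the non-faces $\tau\subseteq[n]$, $\tau\notin Y$. Costa--Farber model: a probability distribution on $\Delta_n^{(r)}$. One selects a vector $\tilde{\mathbf p}=(\tilde p_0,\dots,\tilde p_r,0,\dots,0)$ with $0\le\tilde p_l\le1$ for $0\le l\le r$. One retains each of the $n$ vertices with probability $\tilde p_0$; for each pair of remaining vertices one forms the edge with probability $\tilde p_1$; for each triple of vertices pairwise joined by an edge one forms the 2-dimensional face with probability $\tilde p_2$; and so on. General model: given a degree bound $D>0$ and probabilities $p_\alpha\in[0,1]$ for $\alpha\in\mathbb N^n$ with $0<|\alpha|=\|\alpha\|_1=\sum_i\alpha_i\le D$, each monomial $x^\alpha$ is selected (independently) with probability $p_\alpha$ into a random set $B$, and the induced random monomial ideal is $(B)$, with $(\emptyset)=(0)$.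
   Formalization: The equality P_CF(Y)=P(I_Y) is stated for Y whose ideal I_Y is generated in degrees at most r+1 (it can fail otherwise); for every Y, P_CF(Y) is instead shown to equal the probability that the random ideal agrees with I_Y in degrees at most r+1. *)

theory Defs
  imports "HOL-Library.Poly_Mapping" "HOL-Probability.Probability" "HOL-Probability.Product_PMF"
begin

section \<open>Polynomials and monomial ideals\<close>

text \<open>
  The finite type \<open>'n\<close> plays the role of \<open>[n]\<close>, with \<open>n = CARD('n)\<close>. It indexes both the vertices
  and the variables. Exponent vectors are finitely supported functions into the naturals (here the
  support is automatically finite), and a polynomial is a finitely supported
  family of coefficients indexed by exponent vectors.
\<close>

type_synonym 'n expo = "'n \<Rightarrow>\<^sub>0 nat"
type_synonym ('n, 'k) mpoly = "('n \<Rightarrow>\<^sub>0 nat) \<Rightarrow>\<^sub>0 'k"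

definition expo_deg :: "'n::finite expo \<Rightarrow> nat" where
  "expo_deg \<alpha> = (\<Sum>i\<in>UNIV. Poly_Mapping.lookup \<alpha> i)"

definition mon :: "'n expo \<Rightarrow> ('n, 'k::field) mpoly" where
  "mon \<alpha> = Poly_Mapping.single \<alpha> 1"

definition Var :: "'n \<Rightarrow> ('n, 'k::field) mpoly" where
  "Var i = mon (Poly_Mapping.single i 1)"

text \<open>The ideal generated by \<open>S\<close> is the span of \<open>S\<close> in the ring viewed as a module over itself.\<close>

definition ideal_gen :: "'a::comm_ring_1 set \<Rightarrow> 'a set" where
  "ideal_gen S = module.span (*) S"

text \<open>
  The part of an ideal in degrees at most \<open>D\<close>. The model with degree bound \<open>D\<close> only produces ideals
  \<open>I\<close> with \<open>ideal_gen (upto_degree D I) = I\<close>, whereas the Stanley--Reisner ideal of an \<open>r\<close>-dimensional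
  complex has a minimal generator of degree \<open>r + 2\<close> for every missing \<open>(r+1)\<close>-simplex whose boundary
  is present (a triangle in a graph, say).
\<close>

definition upto_degree :: "nat \<Rightarrow> ('n::finite, 'k::field) mpoly set \<Rightarrow> ('n, 'k) mpoly set" where
  "upto_degree D I = {f \<in> I. \<forall>\<alpha>\<in>Poly_Mapping.keys f. expo_deg \<alpha> \<le> D}"


section \<open>Simplicial complexes and Stanley--Reisner ideals\<close>

definition simplicial_complex :: "'n set set \<Rightarrow> bool" where
  "simplicial_complex Y \<longleftrightarrow> (\<forall>\<sigma>\<in>Y. \<forall>\<tau>. \<tau> \<subseteq> \<sigma> \<longrightarrow> \<tau> \<in> Y)"

definition face_dim :: "'n set \<Rightarrow> int" where
  "face_dim \<sigma> = int (card \<sigma>) - 1"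

definition complexes_of_dim_le :: "nat \<Rightarrow> 'n::finite set set set" where
  "complexes_of_dim_le r = {Y. simplicial_complex Y \<and> (\<forall>\<sigma>\<in>Y. face_dim \<sigma> \<le> int r)}"

definition stanley_reisner :: "'n::finite set set \<Rightarrow> ('n, 'k::field) mpoly set" where
  "stanley_reisner Y = ideal_gen {(\<Prod>i\<in>\<tau>. Var i) | \<tau>. \<tau> \<notin> Y}"


section \<open>The Costa--Farber model\<close>

text \<open>
  \<open>cf_candidates l Y\<close>: the \<open>l\<close>-dimensional simplices all of whose proper faces are already present
  in \<open>Y\<close>. For \<open>l = 0\<close> and \<open>Y = {{}}\<close> these are the \<open>n\<close> vertices, then come the pairs of retained
  vertices, the triples pairwise joined by an edge, and so on.
\<close>

definition cf_candidates :: "nat \<Rightarrow> 'n::finite set set \<Rightarrow> 'n set set" where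
  "cf_candidates l Y = {\<sigma>. card \<sigma> = l + 1 \<and> (\<forall>\<tau>. \<tau> \<subset> \<sigma> \<longrightarrow> \<tau> \<in> Y)}"

text \<open>\<open>cf_skeleton q l\<close> is the distribution of the complex once all faces of dimension \<open>< l\<close> have
  been decided.\<close>

primrec cf_skeleton :: "(nat \<Rightarrow> real) \<Rightarrow> nat \<Rightarrow> 'n::finite set set pmf" where
  "cf_skeleton q 0 = return_pmf {{}}"
| "cf_skeleton q (Suc l) =
     bind_pmf (cf_skeleton q l) (\<lambda>Y.
       map_pmf (\<lambda>b. Y \<union> {\<sigma> \<in> cf_candidates l Y. b \<sigma>})
         (Pi_pmf (cf_candidates l Y) False (\<lambda>_. bernoulli_pmf (q l))))"

text \<open>Only the \<open>n\<close> entries \<open>q 0, \<dots>, q (n - 1)\<close> of the probability vector are used.\<close>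

definition costa_farber :: "(nat \<Rightarrow> real) \<Rightarrow> 'n::finite set set pmf" where
  "costa_farber q = cf_skeleton q CARD('n)"


section \<open>The general model for random monomial ideals\<close>

definition expos_upto :: "nat \<Rightarrow> 'n::finite expo set" where
  "expos_upto D = {\<alpha>. 0 < expo_deg \<alpha> \<and> expo_deg \<alpha> \<le> D}"

definition random_monomials ::
    "nat \<Rightarrow> ('n::finite expo \<Rightarrow> real) \<Rightarrow> ('n, 'k::field) mpoly set pmf" where
  "random_monomials D p =
     map_pmf (\<lambda>b. {mon \<alpha> | \<alpha>. \<alpha> \<in> expos_upto D \<and> b \<alpha>})
       (Pi_pmf (expos_upto D) False (\<lambda>\<alpha>. bernoulli_pmf (p \<alpha>)))"

definition random_monomial_ideal ::
    "nat \<Rightarrow> ('n::finite expo \<Rightarrow> real) \<Rightarrow> ('n, 'k::field) mpoly set pmf" where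
  "random_monomial_ideal D p = map_pmf ideal_gen (random_monomials D p)"

end

theory Submission
  imports Defs
begin

text \<open>
  Both random objects can be read off from the same family of independent coins, one for every
  nonempty vertex set \<open>\<sigma>\<close> with at most \<open>r + 1\<close> elements, where \<open>\<sigma>\<close> is kept with probability
  \<open>q (card \<sigma> - 1)\<close> and rejected otherwise.

  The Costa--Farber process tosses a coin for \<open>\<sigma>\<close> only if all proper faces of \<open>\<sigma>\<close> are present, but
  tossing the remaining coins as well and ignoring them changes nothing. Hence the final complex
  consists of the sets with at most \<open>r + 1\<close> elements none of whose nonempty subsets is rejected
  (\<open>cf_skeleton_eq_surviving_faces\<close>).
  In the general model, all monomials that are not square-free are almost surely absent, and the
  square-free monomial of \<open>\<sigma>\<close> is selected with probability \<open>1 - q (card \<sigma> - 1)\<close>, the probability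
  that \<open>\<sigma>\<close> is rejected. Hence the random ideal is the one generated by the monomials of the
  rejected sets (\<open>random_monomial_ideal_eq_squarefree_ideal\<close>).

  It remains to see that, for each outcome of the coins, the complex is \<open>Y\<close> exactly if the ideal
  agrees with the Stanley--Reisner ideal of \<open>Y\<close> up to degree \<open>r + 1\<close>
  (\<open>upto_degree_rejected_eq_stanley_reisner_iff\<close>). A monomial ideal is determined by the monomials
  in it, and whether a square-free monomial divides \<open>x\<^sup>\<beta>\<close> depends only on the support of \<open>\<beta>\<close>.
  So both ideals are compared through the vertex sets \<open>\<rho>\<close> with at most \<open>r + 1\<close> elements whose
  monomials they contain: for the random ideal these are the \<open>\<rho>\<close> that contain a rejected set, for the
  Stanley--Reisner ideal they are the nonfaces of \<open>Y\<close>.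

  The random ideal is always generated in degrees at most \<open>r + 1\<close>. If the Stanley--Reisner ideal is so
  too, then agreement up to that degree is equality, which gives the pointwise statement.
\<close>

section \<open>Monomial ideals\<close>

interpretation ring_module: module "(*) :: 'a::comm_ring_1 \<Rightarrow> 'a \<Rightarrow> 'a"
  by unfold_locales (simp_all add: algebra_simps)

lemma poly_mapping_as_sum_of_terms:
  fixes f :: "('a \<Rightarrow>\<^sub>0 'b::comm_monoid_add)"
  shows "f = (\<Sum>\<beta>\<in>Poly_Mapping.keys f. Poly_Mapping.single \<beta> (Poly_Mapping.lookup f \<beta>))"
proof (rule poly_mapping_eqI)
  fix \<gamma>
  show "Poly_Mapping.lookup f \<gamma> = Poly_Mapping.lookup
      (\<Sum>\<beta>\<in>Poly_Mapping.keys f. Poly_Mapping.single \<beta> (Poly_Mapping.lookup f \<beta>)) \<gamma>"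
    by (simp add: lookup_sum lookup_single when_def in_keys_iff)
qed

text \<open>
  The polynomials all of whose terms are divisible by a generator form an ideal containing the
  generators. Conversely, each term divisible by a generator is a multiple of it.
\<close>
lemma monomial_ideal_membership:
  fixes f :: "('n, 'k::field) mpoly"
  shows "f \<in> ideal_gen (mon ` A) \<longleftrightarrow>
    (\<forall>\<beta>\<in>Poly_Mapping.keys f. \<exists>\<alpha>\<in>A. \<exists>\<gamma>. \<beta> = \<gamma> + \<alpha>)"
proof
  assume "f \<in> ideal_gen (mon ` A)"
  then have "f \<in> ring_module.span (mon ` A)"
    by (simp add: ideal_gen_def)
  then show "\<forall>\<beta>\<in>Poly_Mapping.keys f. \<exists>\<alpha>\<in>A. \<exists>\<gamma>. \<beta> = \<gamma> + \<alpha>"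
  proof (induction rule: ring_module.span_induct_alt)
    case base
    show ?case by simp
  next
    case (step c x y)
    from step.hyps obtain \<alpha> where \<alpha>: "\<alpha> \<in> A" "x = mon \<alpha>" by auto
    show ?case
    proof
      fix \<beta> assume "\<beta> \<in> Poly_Mapping.keys (c * x + y)"
      then consider "\<beta> \<in> Poly_Mapping.keys (c * x)" | "\<beta> \<in> Poly_Mapping.keys y"
        using Poly_Mapping.keys_add[of "c * x" y] by blast
      then show "\<exists>\<alpha>\<in>A. \<exists>\<gamma>. \<beta> = \<gamma> + \<alpha>"
      proof cases
        case 1
        then show ?thesis
          using keys_mult[of c x] \<alpha> by (force simp: mon_def)
      next
        case 2
        then show ?thesis using step.IH by blast
      qed
    qed
  qed
next
  assume R: "\<forall>\<beta>\<in>Poly_Mapping.keys f. \<exists>\<alpha>\<in>A. \<exists>\<gamma>. \<beta> = \<gamma> + \<alpha>"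
  have "(\<Sum>\<beta>\<in>Poly_Mapping.keys f. Poly_Mapping.single \<beta> (Poly_Mapping.lookup f \<beta>))
      \<in> ring_module.span (mon ` A)"
  proof (rule ring_module.span_sum)
    fix \<beta> assume "\<beta> \<in> Poly_Mapping.keys f"
    with R obtain \<alpha> \<gamma> where *: "\<alpha> \<in> A" "\<beta> = \<gamma> + \<alpha>" by blast
    have "Poly_Mapping.single \<beta> (Poly_Mapping.lookup f \<beta>)
        = Poly_Mapping.single \<gamma> (Poly_Mapping.lookup f \<beta>) * mon \<alpha>"
      by (simp add: mon_def mult_single *)
    with \<open>\<alpha> \<in> A\<close> show "Poly_Mapping.single \<beta> (Poly_Mapping.lookup f \<beta>) \<in> ring_module.span (mon ` A)"
      by (metis imageI ring_module.span_base ring_module.span_scale)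
  qed
  then show "f \<in> ideal_gen (mon ` A)"
    using poly_mapping_as_sum_of_terms[of f] by (simp add: ideal_gen_def)
qed

lemma mon_in_monomial_ideal:
  "(mon \<beta> :: ('n, 'k::field) mpoly) \<in> ideal_gen (mon ` A) \<longleftrightarrow> (\<exists>\<alpha>\<in>A. \<exists>\<gamma>. \<beta> = \<gamma> + \<alpha>)"
  by (simp add: monomial_ideal_membership) (simp add: mon_def)

text \<open>
  Membership is decided term by term, so truncated monomial ideals can be compared on monomials.
\<close>
lemma upto_degree_monomial_ideal_eq_iff:
  fixes A B :: "'n::finite expo set"
  shows "upto_degree D (ideal_gen (mon ` A) :: ('n, 'k::field) mpoly set)
      = upto_degree D (ideal_gen (mon ` B))
    \<longleftrightarrow> (\<forall>\<beta>. expo_deg \<beta> \<le> D \<longrightarrow> (\<exists>\<alpha>\<in>A. \<exists>\<gamma>. \<beta> = \<gamma> + \<alpha>) = (\<exists>\<alpha>\<in>B. \<exists>\<gamma>. \<beta> = \<gamma> + \<alpha>))"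
    (is "?L = ?R")
proof
  assume ?L
  have "mon \<beta> \<in> upto_degree D (ideal_gen (mon ` C) :: ('n, 'k) mpoly set) \<longleftrightarrow>
      (\<exists>\<alpha>\<in>C. \<exists>\<gamma>. \<beta> = \<gamma> + \<alpha>)" if "expo_deg \<beta> \<le> D" for \<beta> C
    using that by (simp add: upto_degree_def mon_in_monomial_ideal) (simp add: mon_def)
  with \<open>?L\<close> show ?R by metis
next
  assume R: ?R
  show ?L
    unfolding upto_degree_def monomial_ideal_membership using R by blast
qed

lemma ideal_gen_upto_degree_of_generators:
  fixes S :: "('n::finite, 'k::field) mpoly set"
  assumes "\<And>f \<alpha>. f \<in> S \<Longrightarrow> \<alpha> \<in> Poly_Mapping.keys f \<Longrightarrow> expo_deg \<alpha> \<le> D"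
  shows "ideal_gen (upto_degree D (ideal_gen S)) = ideal_gen S"
proof -
  have "S \<subseteq> upto_degree D (ideal_gen S)"
    using assms by (auto simp: upto_degree_def ideal_gen_def intro: ring_module.span_base)
  then have "ideal_gen S \<subseteq> ideal_gen (upto_degree D (ideal_gen S))"
    by (simp add: ideal_gen_def ring_module.span_mono)
  moreover have "ideal_gen (upto_degree D (ideal_gen S)) \<subseteq> ideal_gen (ideal_gen S)"
    unfolding ideal_gen_def by (rule ring_module.span_mono) (auto simp: upto_degree_def)
  ultimately show ?thesis
    by (simp add: ideal_gen_def ring_module.span_span)
qed

section \<open>Square-free monomials as vertex sets\<close>

definition expo_of_set :: "'n set \<Rightarrow> 'n expo" where
  "expo_of_set \<sigma> = (\<Sum>i\<in>\<sigma>. Poly_Mapping.single i 1)"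

lemma lookup_expo_of_set:
  "Poly_Mapping.lookup (expo_of_set (\<sigma> :: 'n::finite set)) i = (if i \<in> \<sigma> then 1 else 0)"
  by (simp add: expo_of_set_def lookup_sum lookup_single when_def)

lemma keys_expo_of_set: "Poly_Mapping.keys (expo_of_set (\<sigma> :: 'n::finite set)) = \<sigma>"
  by (auto simp: in_keys_iff lookup_expo_of_set split: if_splits)

lemma inj_expo_of_set: "inj (expo_of_set :: 'n::finite set \<Rightarrow> 'n expo)"
  by (metis injI keys_expo_of_set)

lemma expo_deg_expo_of_set: "expo_deg (expo_of_set \<sigma>) = card (\<sigma> :: 'n::finite set)"
  by (simp add: expo_deg_def lookup_expo_of_set flip: sum.inter_filter)

lemma expo_of_set_eq_0_iff: "expo_of_set (\<sigma> :: 'n::finite set) = 0 \<longleftrightarrow> \<sigma> = {}"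
  by (metis keys_eq_empty keys_expo_of_set)

text \<open>Together with injectivity, this identifies square-free exponent vectors with vertex sets.\<close>
lemma squarefree_expo_eq_expo_of_set:
  fixes \<alpha> :: "'n::finite expo"
  assumes "\<forall>i. Poly_Mapping.lookup \<alpha> i \<in> {0, 1}"
  shows "\<alpha> = expo_of_set (Poly_Mapping.keys \<alpha>)"
proof (rule poly_mapping_eqI)
  fix i
  show "Poly_Mapping.lookup \<alpha> i = Poly_Mapping.lookup (expo_of_set (Poly_Mapping.keys \<alpha>)) i"
    using assms[rule_format, of i] by (auto simp: lookup_expo_of_set in_keys_iff)
qed

lemma expo_of_set_divides_iff:
  fixes \<sigma> :: "'n::finite set"
  shows "(\<exists>\<gamma>. \<beta> = \<gamma> + expo_of_set \<sigma>) \<longleftrightarrow> \<sigma> \<subseteq> Poly_Mapping.keys \<beta>"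
proof
  assume "\<exists>\<gamma>. \<beta> = \<gamma> + expo_of_set \<sigma>"
  then show "\<sigma> \<subseteq> Poly_Mapping.keys \<beta>"
    by (auto simp: in_keys_iff lookup_add lookup_expo_of_set)
next
  assume "\<sigma> \<subseteq> Poly_Mapping.keys \<beta>"
  then have "\<beta> = (\<beta> - expo_of_set \<sigma>) + expo_of_set \<sigma>"
    by (intro poly_mapping_eqI)
       (auto simp: lookup_add lookup_minus lookup_expo_of_set in_keys_iff)
  then show "\<exists>\<gamma>. \<beta> = \<gamma> + expo_of_set \<sigma>" ..
qed

lemma card_keys_le_expo_deg: "card (Poly_Mapping.keys \<beta>) \<le> expo_deg (\<beta> :: 'n::finite expo)"
proof -
  have "card (Poly_Mapping.keys \<beta>) = (\<Sum>i\<in>Poly_Mapping.keys \<beta>. 1)" by simp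
  also have "\<dots> \<le> (\<Sum>i\<in>Poly_Mapping.keys \<beta>. Poly_Mapping.lookup \<beta> i)"
    by (rule sum_mono) (simp add: in_keys_iff Suc_leI)
  also have "\<dots> \<le> expo_deg \<beta>"
    unfolding expo_deg_def by (rule sum_mono2) auto
  finally show ?thesis .
qed

lemma prod_Var_eq_mon: "(\<Prod>i\<in>\<tau>. Var i :: ('n::finite, 'k::field) mpoly) = mon (expo_of_set \<tau>)"
proof -
  have "finite \<tau>" by simp
  then show ?thesis
    by (induction \<tau> rule: finite_induct)
       (simp_all add: expo_of_set_def Var_def mon_def mult_single)
qed

definition squarefree_ideal :: "'n::finite set set \<Rightarrow> ('n, 'k::field) mpoly set" where
  "squarefree_ideal T = ideal_gen (mon ` expo_of_set ` T)"

lemma stanley_reisner_eq_squarefree_ideal: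
  "stanley_reisner Y = (squarefree_ideal (- Y) :: ('n::finite, 'k::field) mpoly set)"
  unfolding stanley_reisner_def squarefree_ideal_def prod_Var_eq_mon
  by (rule arg_cong[of _ _ ideal_gen]) auto

text \<open>
  Divisibility by a square-free monomial sees only the support of an exponent vector \<open>\<beta>\<close>. The support
  has at most \<open>expo_deg \<beta>\<close> elements, and every set \<open>\<rho>\<close> is the support of a vector of degree exactly
  \<open>card \<rho>\<close>. So the bound \<open>D\<close> on degrees turns into the same bound on cardinalities.
\<close>
lemma upto_degree_squarefree_ideal_eq_iff:
  fixes T T' :: "'n::finite set set"
  shows "upto_degree D (squarefree_ideal T :: ('n, 'k::field) mpoly set)
      = upto_degree D (squarefree_ideal T')
    \<longleftrightarrow> (\<forall>\<rho>. card \<rho> \<le> D \<longrightarrow> (\<exists>\<sigma>\<in>T. \<sigma> \<subseteq> \<rho>) = (\<exists>\<sigma>\<in>T'. \<sigma> \<subseteq> \<rho>))"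
proof -
  have "upto_degree D (squarefree_ideal T :: ('n, 'k) mpoly set) = upto_degree D (squarefree_ideal T')
    \<longleftrightarrow> (\<forall>\<beta>. expo_deg \<beta> \<le> D \<longrightarrow> (\<exists>\<sigma>\<in>T. \<sigma> \<subseteq> Poly_Mapping.keys \<beta>)
          = (\<exists>\<sigma>\<in>T'. \<sigma> \<subseteq> Poly_Mapping.keys \<beta>))"
    by (simp add: squarefree_ideal_def upto_degree_monomial_ideal_eq_iff expo_of_set_divides_iff)
  also have "\<dots> \<longleftrightarrow> (\<forall>\<rho>. card \<rho> \<le> D \<longrightarrow> (\<exists>\<sigma>\<in>T. \<sigma> \<subseteq> \<rho>) = (\<exists>\<sigma>\<in>T'. \<sigma> \<subseteq> \<rho>))"
    (is "?L = ?R")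
  proof
    show "?L \<Longrightarrow> ?R"
      using expo_deg_expo_of_set keys_expo_of_set by metis
    show "?R \<Longrightarrow> ?L"
      using card_keys_le_expo_deg le_trans by blast
  qed
  finally show ?thesis .
qed

section \<open>Independent choices\<close>

lemma map_Not_bernoulli_pmf:
  assumes "0 \<le> x" "x \<le> 1"
  shows "map_pmf Not (bernoulli_pmf x) = bernoulli_pmf (1 - x)"
proof (rule pmf_eqI)
  fix b
  have "pmf (map_pmf Not (bernoulli_pmf x)) (\<not> \<not> b) = pmf (bernoulli_pmf x) (\<not> b)"
    by (rule pmf_map_inj') (auto intro: injI)
  then show "pmf (map_pmf Not (bernoulli_pmf x)) b = pmf (bernoulli_pmf (1 - x)) b"
    using assms by (cases b) simp_all
qed

lemma bernoulli_pmf_0: "bernoulli_pmf 0 = return_pmf False"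
  by (rule pmf_eqI) (simp add: pmf_return indicator_def split: bool.split)

text \<open>
  Renaming the index set of an independent family, where the distributions may vary with the index.
  Injectivity of \<open>h\<close> on the whole type ensures that \<open>g \<circ> h\<close> takes the default value outside \<open>A\<close>.
\<close>
lemma Pi_pmf_reindex:
  assumes "finite A" "inj h"
  shows "Pi_pmf A d (\<lambda>x. f (h x)) = map_pmf (\<lambda>g. g \<circ> h) (Pi_pmf (h ` A) d f)"
  using assms(1)
proof (induction A rule: finite_induct)
  case empty
  show ?case by (simp add: o_def)
next
  case (insert x A)
  have fresh: "h x \<notin> h ` A"
    using insert.hyps assms(2) by (auto dest: injD)
  have update: "(g(h x := y)) \<circ> h = (g \<circ> h)(x := y)" for g :: "'b \<Rightarrow> 'c" and y
    using assms(2) by (auto simp: fun_eq_iff dest: injD)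
  have "Pi_pmf (insert x A) d (\<lambda>x. f (h x)) =
      map_pmf (\<lambda>(y, g). (g \<circ> h)(x := y)) (pair_pmf (f (h x)) (Pi_pmf (h ` A) d f))"
    by (simp add: Pi_pmf_insert insert pair_map_pmf2 pmf.map_comp)
       (rule map_pmf_cong, auto)
  also have "\<dots> = map_pmf (\<lambda>g. g \<circ> h) (Pi_pmf (h ` insert x A) d f)"
    unfolding image_insert Pi_pmf_insert[OF finite_imageI[OF insert.hyps(1)] fresh] pmf.map_comp
    by (rule map_pmf_cong) (auto simp: update simp del: fun_upd_apply)
  finally show ?case .
qed

text \<open>
  Selecting with probability \<open>1 - q x\<close> amounts to negating a coin of bias \<open>q x\<close>. The conjunct
  \<open>x \<in> A\<close> keeps the default value \<open>False\<close> outside \<open>A\<close>, which plain negation would turn into \<open>True\<close>.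
\<close>
lemma Pi_pmf_bernoulli_negate:
  assumes "finite A" and "\<And>x. x \<in> A \<Longrightarrow> 0 \<le> q x \<and> q x \<le> 1"
  shows "Pi_pmf A False (\<lambda>x. bernoulli_pmf (1 - q x)) =
    map_pmf (\<lambda>c x. x \<in> A \<and> \<not> c x) (Pi_pmf A False (\<lambda>x. bernoulli_pmf (q x)))"
proof -
  have "Pi_pmf A False (\<lambda>x. bernoulli_pmf (1 - q x))
      = Pi_pmf A False (\<lambda>x. map_pmf Not (bernoulli_pmf (q x)))"
    using assms(2) by (intro Pi_pmf_cong) (simp_all add: map_Not_bernoulli_pmf)
  also have "\<dots> = map_pmf (\<lambda>h. Not \<circ> h) (Pi_pmf A True (\<lambda>x. bernoulli_pmf (q x)))"
    by (rule Pi_pmf_map) (simp_all add: assms(1))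
  also have "Pi_pmf A True (\<lambda>x. bernoulli_pmf (q x)) =
      map_pmf (\<lambda>f x. if x \<in> A then f x else True) (Pi_pmf A False (\<lambda>x. bernoulli_pmf (q x)))"
    by (rule Pi_pmf_default_swap[symmetric]) (fact assms(1))
  finally show ?thesis
    by (simp add: pmf.map_comp o_def if_distrib[of Not] cong: if_cong)
       (rule map_pmf_cong, auto)
qed

section \<open>The Costa--Farber complex from independent choices\<close>

definition potential_faces :: "nat \<Rightarrow> 'n::finite set set" where
  "potential_faces l = {\<sigma>. 0 < card \<sigma> \<and> card \<sigma> \<le> l}"

text \<open>
  The empty set is always a face, also in the Costa--Farber process, which starts from \<open>{{}}\<close>.
  Hence only nonempty subsets need a successful coin.
\<close>
definition surviving_faces :: "nat \<Rightarrow> ('n::finite set \<Rightarrow> bool) \<Rightarrow> 'n set set" where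
  "surviving_faces l c = {\<sigma>. card \<sigma> \<le> l \<and> (\<forall>\<tau>. \<tau> \<subseteq> \<sigma> \<longrightarrow> \<tau> \<noteq> {} \<longrightarrow> c \<tau>)}"

definition face_choices :: "(nat \<Rightarrow> real) \<Rightarrow> nat \<Rightarrow> ('n::finite set \<Rightarrow> bool) pmf" where
  "face_choices q l = Pi_pmf (potential_faces l) False (\<lambda>\<sigma>. bernoulli_pmf (q (card \<sigma> - 1)))"

text \<open>
  One step of the Costa--Farber process for fixed coins: a set with \<open>l + 1\<close> elements survives if all
  its proper subsets do, which means that it is a candidate, and its own coin \<open>g\<close> succeeds.
\<close>
lemma surviving_faces_Suc:
  fixes f g :: "'n::finite set \<Rightarrow> bool"
  shows "surviving_faces (Suc l) (\<lambda>\<sigma>. if \<sigma> \<in> potential_faces l then f \<sigma> else g \<sigma>)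
    = surviving_faces l f \<union> {\<sigma> \<in> cf_candidates l (surviving_faces l f). g \<sigma>}"
    (is "?L = ?R")
proof (rule set_eqI)
  fix \<sigma> :: "'n set"
  have small: "\<tau> \<in> potential_faces l" if "\<tau> \<subseteq> \<rho>" "\<tau> \<noteq> {}" "card \<rho> \<le> l" for \<tau> \<rho> :: "'n set"
    using that card_mono[of \<rho> \<tau>] by (auto simp: potential_faces_def card_gt_0_iff)
  consider "card \<sigma> \<le> l" | "card \<sigma> = Suc l" | "card \<sigma> > Suc l" by linarith
  then show "\<sigma> \<in> ?L \<longleftrightarrow> \<sigma> \<in> ?R"
  proof cases
    case 1
    then show ?thesis
      using small[of _ \<sigma>] by (auto simp: surviving_faces_def cf_candidates_def)
  next
    case 2
    have proper: "card \<tau> \<le> l" if "\<tau> \<subset> \<sigma>" for \<tau>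
      using that 2 psubset_card_mono[of \<sigma> \<tau>] by simp
    have "\<sigma> \<notin> potential_faces l" "\<sigma> \<noteq> {}"
      using 2 by (auto simp: potential_faces_def)
    then have "\<sigma> \<in> ?L \<longleftrightarrow> (\<forall>\<tau>. \<tau> \<subset> \<sigma> \<longrightarrow> \<tau> \<noteq> {} \<longrightarrow> f \<tau>) \<and> g \<sigma>"
      using 2 small[OF subset_refl _ proper] by (auto simp: surviving_faces_def subset_iff_psubset_eq)
    also have "\<dots> \<longleftrightarrow> \<sigma> \<in> ?R"
      using 2 proper by (auto simp: surviving_faces_def cf_candidates_def)
    finally show ?thesis .
  next
    case 3
    then show ?thesis
      by (auto simp: surviving_faces_def cf_candidates_def)
  qed
qed

text \<open>
  The process tosses coins only for the candidates, a set that depends on the earlier coins. For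
  fixed earlier coins, these tosses are the restriction to the candidates of independent coins for
  all sets with \<open>l + 1\<close> elements, and the latter family no longer depends on the past.
\<close>
lemma cf_skeleton_eq_surviving_faces:
  "cf_skeleton q l = map_pmf (surviving_faces l) (face_choices q l :: ('n::finite set \<Rightarrow> bool) pmf)"
proof (induction l)
  case 0
  have "potential_faces 0 = ({} :: 'n set set)"
    by (auto simp: potential_faces_def)
  moreover have "surviving_faces 0 c = {{}}" for c :: "'n set \<Rightarrow> bool"
    by (auto simp: surviving_faces_def)
  ultimately show ?case
    by (simp add: face_choices_def)
next
  case (Suc l)
  define N :: "'n set set" where "N = {\<sigma>. card \<sigma> = Suc l}"
  let ?cand = "\<lambda>f :: 'n set \<Rightarrow> bool. cf_candidates l (surviving_faces l f)"
  let ?new = "Pi_pmf N False (\<lambda>_. bernoulli_pmf (q l))"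
  let ?glue = "\<lambda>f g \<sigma>. if \<sigma> \<in> potential_faces l then f \<sigma> else g (\<sigma> :: 'n set)"
  have split: "potential_faces (Suc l) = potential_faces l \<union> N" "potential_faces l \<inter> N = {}"
    by (auto simp: potential_faces_def N_def)
  have new: "Pi_pmf N False (\<lambda>\<sigma>. bernoulli_pmf (q (card \<sigma> - 1))) = ?new"
    by (rule Pi_pmf_cong) (auto simp: N_def)
  have tossed: "Pi_pmf (?cand f) False (\<lambda>_. bernoulli_pmf (q l)) =
      map_pmf (\<lambda>g \<sigma>. if \<sigma> \<in> ?cand f then g \<sigma> else False) ?new" for f
    by (rule Pi_pmf_subset) (auto simp: N_def cf_candidates_def)
  have union: "surviving_faces l f \<union>
      {\<sigma> \<in> ?cand f. if \<sigma> \<in> ?cand f then g \<sigma> else False} = surviving_faces (Suc l) (?glue f g)" for f g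
    by (auto simp: surviving_faces_Suc)
  have "cf_skeleton q (Suc l) = face_choices q l \<bind> (\<lambda>f. map_pmf (\<lambda>g. surviving_faces (Suc l) (?glue f g)) ?new)"
    by (simp only: cf_skeleton.simps Suc.IH bind_map_pmf tossed pmf.map_comp o_def union)
  also have "\<dots> = map_pmf (surviving_faces (Suc l)) (face_choices q (Suc l))"
    unfolding face_choices_def split(1) Pi_pmf_union[OF finite finite split(2)] new
    by (simp add: pair_pmf_def map_pmf_def bind_assoc_pmf bind_return_pmf)
  finally show ?case .
qed

text \<open>Dimensions whose probability is 0 contribute no faces, so the construction may stop early.\<close>
lemma cf_skeleton_stable:
  assumes "m \<le> l" and "\<And>i. m \<le> i \<Longrightarrow> i < l \<Longrightarrow> q i = 0"
  shows "(cf_skeleton q l :: 'n::finite set set pmf) = cf_skeleton q m"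
  using assms
proof (induction l rule: dec_induct)
  case base
  show ?case ..
next
  case (step l)
  then show ?case
    by (simp add: bernoulli_pmf_0 bind_return_pmf')
qed

section \<open>The random ideal from the same choices\<close>

definition rejected_faces :: "nat \<Rightarrow> ('n::finite set \<Rightarrow> bool) \<Rightarrow> 'n set set" where
  "rejected_faces l c = {\<sigma> \<in> potential_faces l. \<not> c \<sigma>}"

lemma finite_expos_upto: "finite (expos_upto D :: 'n::finite expo set)"
proof (rule inj_on_finite)
  show "inj_on Poly_Mapping.lookup (expos_upto D :: 'n expo set)"
    by (auto intro: inj_onI poly_mapping_eqI)
  show "Poly_Mapping.lookup ` expos_upto D \<subseteq> (UNIV :: 'n set) \<rightarrow>\<^sub>E {..D}"
  proof -
    have "Poly_Mapping.lookup \<alpha> i \<le> D" if "\<alpha> \<in> expos_upto D" for \<alpha> :: "'n expo" and i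
    proof -
      have "Poly_Mapping.lookup \<alpha> i \<le> expo_deg \<alpha>"
        unfolding expo_deg_def by (rule member_le_sum) auto
      with that show ?thesis by (simp add: expos_upto_def)
    qed
    then show ?thesis by auto
  qed
  show "finite ((UNIV :: 'n set) \<rightarrow>\<^sub>E {..D})"
    by (rule finite_PiE) auto
qed

text \<open>
  Monomials that are not square-free are selected with probability 0 and can be dropped. The others
  are indexed by the nonempty sets with at most \<open>r + 1\<close> elements, since the degree of a square-free
  monomial is the cardinality of its support.
\<close>
lemma random_monomial_ideal_eq_squarefree_ideal:
  fixes p :: "'n::finite expo \<Rightarrow> real"
  assumes q: "\<And>l. l \<le> r \<Longrightarrow> 0 \<le> q l \<and> q l \<le> 1"
    and p: "\<And>\<alpha>. 0 < expo_deg \<alpha> \<Longrightarrow> expo_deg \<alpha> \<le> r + 1 \<Longrightarrow>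
        p \<alpha> = (if \<alpha> \<noteq> 0 \<and> (\<forall>i. Poly_Mapping.lookup \<alpha> i \<in> {0, 1}) then 1 - q (expo_deg \<alpha> - 1) else 0)"
  shows "(random_monomial_ideal (r + 1) p :: ('n, 'k::field) mpoly set pmf) =
    map_pmf (\<lambda>c. squarefree_ideal (rejected_faces (r + 1) c)) (face_choices q (r + 1))"
proof -
  let ?S = "potential_faces (r + 1) :: 'n set set"
  let ?E = "expo_of_set ` ?S"
  have E_sub: "?E \<subseteq> expos_upto (r + 1)"
    by (auto simp: expos_upto_def potential_faces_def expo_deg_expo_of_set)
  have p_E: "p (expo_of_set \<sigma>) = 1 - q (card \<sigma> - 1)" if "\<sigma> \<in> ?S" for \<sigma>
  proof -
    have "0 < card \<sigma>" "card \<sigma> \<le> r + 1" "\<sigma> \<noteq> {}"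
      using that by (auto simp: potential_faces_def)
    then show ?thesis
      using p[of "expo_of_set \<sigma>"]
      by (simp add: expo_deg_expo_of_set expo_of_set_eq_0_iff lookup_expo_of_set)
  qed
  have p_not_E: "bernoulli_pmf (p \<alpha>) = return_pmf False" if "\<alpha> \<in> expos_upto (r + 1) - ?E" for \<alpha>
  proof -
    have "\<not> (\<forall>i. Poly_Mapping.lookup \<alpha> i \<in> {0, 1})"
    proof
      assume "\<forall>i. Poly_Mapping.lookup \<alpha> i \<in> {0, 1}"
      then have eq: "\<alpha> = expo_of_set (Poly_Mapping.keys \<alpha>)"
        by (rule squarefree_expo_eq_expo_of_set)
      then have "expo_deg \<alpha> = card (Poly_Mapping.keys \<alpha>)"
        by (metis expo_deg_expo_of_set)
      with that have "Poly_Mapping.keys \<alpha> \<in> ?S"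
        by (simp add: potential_faces_def expos_upto_def)
      with eq have "\<alpha> \<in> ?E" by blast
      with that show False by simp
    qed
    moreover have "0 < expo_deg \<alpha>" "expo_deg \<alpha> \<le> r + 1"
      using that by (simp_all add: expos_upto_def)
    ultimately have "p \<alpha> = 0"
      by (subst p) (simp_all only: simp_thms if_False)
    then show ?thesis by (simp add: bernoulli_pmf_0)
  qed
  let ?P = "Pi_pmf ?E False (\<lambda>\<alpha>. bernoulli_pmf (p \<alpha>))"
  have "(random_monomials (r + 1) p :: ('n, 'k) mpoly set pmf)
      = map_pmf (\<lambda>b. {mon \<alpha> | \<alpha>. \<alpha> \<in> expos_upto (r + 1) \<and> b \<alpha>}) ?P"
    unfolding random_monomials_def
    by (subst Pi_pmf_subset'[OF finite_expos_upto E_sub p_not_E]) auto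
  \<comment> \<open>Outside \<open>?E\<close> every outcome takes the default value \<open>False\<close>, so nothing else is selected.\<close>
  also have "\<dots> = map_pmf (\<lambda>b. mon ` expo_of_set ` {\<sigma> \<in> ?S. (b \<circ> expo_of_set) \<sigma>}) ?P"
  proof (rule map_pmf_cong)
    fix b assume "b \<in> set_pmf ?P"
    then have "\<alpha> \<in> ?E" if "b \<alpha>" for \<alpha>
      using that set_Pi_pmf_subset[of ?E False "\<lambda>\<alpha>. bernoulli_pmf (p \<alpha>)"] by auto
    then show "{mon \<alpha> | \<alpha>. \<alpha> \<in> expos_upto (r + 1) \<and> b \<alpha>}
        = (mon ` expo_of_set ` {\<sigma> \<in> ?S. (b \<circ> expo_of_set) \<sigma>} :: ('n, 'k) mpoly set)"
      using E_sub by fastforce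
  qed simp
  also have "\<dots> = map_pmf (\<lambda>b. mon ` expo_of_set ` {\<sigma> \<in> ?S. b \<sigma>}) (map_pmf (\<lambda>b. b \<circ> expo_of_set) ?P)"
    by (simp add: pmf.map_comp o_def)
  also have "map_pmf (\<lambda>b. b \<circ> expo_of_set) ?P = Pi_pmf ?S False (\<lambda>\<sigma>. bernoulli_pmf (p (expo_of_set \<sigma>)))"
    by (rule Pi_pmf_reindex[symmetric]) (simp_all add: inj_expo_of_set)
  also have "\<dots> = Pi_pmf ?S False (\<lambda>\<sigma>. bernoulli_pmf (1 - q (card \<sigma> - 1)))"
    by (rule Pi_pmf_cong) (simp_all add: p_E)
  also have "\<dots> = map_pmf (\<lambda>c \<sigma>. \<sigma> \<in> ?S \<and> \<not> c \<sigma>) (face_choices q (r + 1))"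
    unfolding face_choices_def
    by (rule Pi_pmf_bernoulli_negate) (auto simp: potential_faces_def intro!: q)
  finally show ?thesis
    by (simp add: random_monomial_ideal_def pmf.map_comp o_def squarefree_ideal_def rejected_faces_def)
qed

section \<open>Comparing the two models\<close>

lemma surviving_faces_iff_no_rejected_subset:
  assumes "card \<rho> \<le> l"
  shows "\<rho> \<in> surviving_faces l c \<longleftrightarrow> \<not> (\<exists>\<sigma>\<in>rejected_faces l c. \<sigma> \<subseteq> (\<rho> :: 'n::finite set))"
proof -
  have "\<sigma> \<in> potential_faces l \<longleftrightarrow> \<sigma> \<noteq> {}" if "\<sigma> \<subseteq> \<rho>" for \<sigma>
    using card_mono[OF _ that] assms by (auto simp: potential_faces_def card_gt_0_iff)
  with assms show ?thesis
    by (auto simp: surviving_faces_def rejected_faces_def)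
qed

text \<open>
  A set contains a nonface of \<open>Y\<close> exactly if it is one, because \<open>Y\<close> is closed under subsets. Sets with
  more than \<open>r + 1\<close> elements cannot distinguish the two complexes, as neither of them has such faces.
  This includes \<open>Y = {}\<close>: then the Stanley--Reisner ideal contains the constant 1, and neither side of
  the equivalence can hold.
\<close>
lemma upto_degree_rejected_eq_stanley_reisner_iff:
  fixes Y :: "'n::finite set set"
  assumes Y: "Y \<in> complexes_of_dim_le r"
  shows "upto_degree (r + 1) (squarefree_ideal (rejected_faces (r + 1) c) :: ('n, 'k::field) mpoly set)
      = upto_degree (r + 1) (stanley_reisner Y)
    \<longleftrightarrow> surviving_faces (r + 1) c = Y"
proof -
  have small: "card \<rho> \<le> r + 1" if "\<rho> \<in> Y" for \<rho>
    using that Y by (auto simp: complexes_of_dim_le_def face_dim_def)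
  have nonface: "(\<exists>\<sigma>\<in>-Y. \<sigma> \<subseteq> \<rho>) \<longleftrightarrow> \<rho> \<notin> Y" for \<rho>
    using Y by (auto simp: complexes_of_dim_le_def simplicial_complex_def)
  have "upto_degree (r + 1) (squarefree_ideal (rejected_faces (r + 1) c) :: ('n, 'k::field) mpoly set)
      = upto_degree (r + 1) (stanley_reisner Y)
    \<longleftrightarrow> (\<forall>\<rho>. card \<rho> \<le> r + 1 \<longrightarrow> (\<exists>\<sigma>\<in>rejected_faces (r + 1) c. \<sigma> \<subseteq> \<rho>) = (\<rho> \<notin> Y))"
    by (simp only: stanley_reisner_eq_squarefree_ideal upto_degree_squarefree_ideal_eq_iff nonface)
  also have "\<dots> \<longleftrightarrow> (\<forall>\<rho>. card \<rho> \<le> r + 1 \<longrightarrow> (\<rho> \<in> surviving_faces (r + 1) c) = (\<rho> \<in> Y))"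
    using surviving_faces_iff_no_rejected_subset by blast
  also have "\<dots> \<longleftrightarrow> surviving_faces (r + 1) c = Y"
  proof -
    have "card \<rho> \<le> r + 1" if "\<rho> \<in> surviving_faces (r + 1) c" for \<rho>
      using that by (simp add: surviving_faces_def)
    with small show ?thesis by blast
  qed
  finally show ?thesis .
qed

text \<open>
  An ideal generated in degrees at most \<open>l\<close> is determined by its truncation, so for two such ideals
  agreement up to degree \<open>l\<close> is equality.
\<close>
lemma squarefree_ideal_rejected_generated_upto_degree:
  "ideal_gen (upto_degree l (squarefree_ideal (rejected_faces l c)))
    = (squarefree_ideal (rejected_faces l c) :: ('n::finite, 'k::field) mpoly set)"
  unfolding squarefree_ideal_def
  by (rule ideal_gen_upto_degree_of_generators)
     (auto simp: mon_def rejected_faces_def potential_faces_def expo_deg_expo_of_set)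

theorem theorem5p2:
  fixes q :: "nat \<Rightarrow> real"
    and r D :: nat
    and Y :: "'n::finite set set"
    and I\<^sub>Y :: "('n, 'k::field) mpoly set"
    and p :: "'n expo \<Rightarrow> real"
  assumes r: "r < CARD('n)"
    and q_prob: "\<And>l. l \<le> r \<Longrightarrow> 0 \<le> q l \<and> q l \<le> 1"
    and q_zero: "\<And>l. r < l \<Longrightarrow> l < CARD('n) \<Longrightarrow> q l = 0"
    and Y: "Y \<in> complexes_of_dim_le r"
    and I\<^sub>Y: "I\<^sub>Y = stanley_reisner Y"
    and D: "D = r + 1"
    and p: "\<And>\<alpha>. 0 < expo_deg \<alpha> \<Longrightarrow> expo_deg \<alpha> \<le> r + 1 \<Longrightarrow>
        p \<alpha> = (if \<alpha> \<noteq> 0 \<and> (\<forall>i. Poly_Mapping.lookup \<alpha> i \<in> {0, 1}) then 1 - q (expo_deg \<alpha> - 1) else 0)"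
  shows "(ideal_gen (upto_degree D I\<^sub>Y) = I\<^sub>Y \<longrightarrow>
            pmf (costa_farber q) Y = pmf (random_monomial_ideal D p) I\<^sub>Y) \<and>
         pmf (costa_farber q) Y =
           measure_pmf.prob (random_monomial_ideal D p) {I. upto_degree D I = upto_degree D I\<^sub>Y}"
proof -
  let ?coins = "face_choices q (r + 1) :: ('n set \<Rightarrow> bool) pmf"
  let ?J = "\<lambda>c. squarefree_ideal (rejected_faces (r + 1) c) :: ('n, 'k) mpoly set"
  have "costa_farber q = (cf_skeleton q (r + 1) :: 'n set set pmf)"
    unfolding costa_farber_def by (rule cf_skeleton_stable) (use r q_zero in auto)
  then have cf: "pmf (costa_farber q) Y =
      measure_pmf.prob ?coins {c. surviving_faces (r + 1) c = Y}"
    by (simp add: cf_skeleton_eq_surviving_faces pmf_map vimage_def)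
  have ideals: "random_monomial_ideal D p = map_pmf ?J ?coins"
    unfolding D by (rule random_monomial_ideal_eq_squarefree_ideal[OF q_prob p])
  have same: "upto_degree D (?J c) = upto_degree D I\<^sub>Y \<longleftrightarrow> surviving_faces (r + 1) c = Y" for c
    unfolding D I\<^sub>Y by (rule upto_degree_rejected_eq_stanley_reisner_iff[OF Y])
  have "pmf (costa_farber q) Y = pmf (random_monomial_ideal D p) I\<^sub>Y"
    if gen: "ideal_gen (upto_degree D I\<^sub>Y) = I\<^sub>Y"
  proof -
    have "?J c = I\<^sub>Y \<longleftrightarrow> surviving_faces (r + 1) c = Y" for c
      using same gen squarefree_ideal_rejected_generated_upto_degree[of "r + 1" c] D by metis
    then show ?thesis
      unfolding cf ideals by (simp add: pmf_map vimage_def)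
  qed
  moreover have "pmf (costa_farber q) Y =
      measure_pmf.prob (random_monomial_ideal D p) {I. upto_degree D I = upto_degree D I\<^sub>Y}"
    unfolding cf ideals by (simp only: measure_map_pmf vimage_def mem_Collect_eq same)
  ultimately show ?thesis by blast
qed

end
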